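(* Let $Q=(q_{ij})$ be a real symmetric $n\times n$ matrix with zero diagonal, $c\in\mathbb{R}^n$, $R_i=\{j:q_{ij}\neq0\}$, and let $\alpha_{ij}>0$, $\gamma_{ij}>0$ for $j\in R_i$, $i=1,\dots,n$. Consider the MILP FT($\alpha,\gamma,*$) in variables $x_i$ and $y_{ij}$ ($j\in R_i$): maximize $\sum_{i=1}^n\sum_{j\in R_i}q_{ij}y_{ij}+\sum_{i=1}^n c_ix_i$ subject to $\sum_{j\in R_i}\alpha_{ij}(x_j-y_{ij})\le\left(\sum_{j\in R_i}\alpha_{ij}\right)(1-x_i)$ for $i=1,\dots,n$; $\sum_{j\in R_i}\gamma_{ij}y_{ij}\le\left(\sum_{j\in R_i}\gamma_{ij}\right)x_i$ for $i=1,\dots,n$; $y_{ij}\le y_{ji}$ for all $j\in R_i$, $i=1,\dots,n$; $x_i\in\{0,1\}$ for all $i$; $0\le y_{ij}\le 1$ for all $j\in R_i$, $i=1,\dots,n$. Then FT($\alpha,\gamma,*$) is a valid formulation of QUBO.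
   Context: QUBO is the problem: maximize $\sum_{i=1}^n\sum_{j\in R_i}q_{ij}x_ix_j+\sum_{i=1}^n c_ix_i$ over $x\in\{0,1\}^n$. An MILP in variables $(x,y)$ with objective $\sum_i\sum_{j\in R_i}q_{ij}y_{ij}+\sum_i c_ix_i$ is a valid formulation of QUBO if its optimal objective value equals the optimal value of QUBO and the $x$-part of every optimal solution of the MILP is an optimal solution of QUBO. *)

theory Defs
  imports "HOL-Analysis.Analysis"
begin

definition nbr :: "real ^ 'n ^ 'n \<Rightarrow> 'n \<Rightarrow> 'n set" where
  "nbr Q i = {j. Q $ i $ j \<noteq> 0}"

definition binary_points :: "(real ^ 'n) set" where
  "binary_points = {x. \<forall>i. x $ i \<in> {0, 1}}"

definition qubo_obj :: "real ^ 'n ^ 'n \<Rightarrow> real ^ 'n \<Rightarrow> real ^ 'n \<Rightarrow> real" where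
  "qubo_obj Q c x =
     (\<Sum>i\<in>UNIV. \<Sum>j\<in>nbr Q i. Q $ i $ j * x $ i * x $ j) + (\<Sum>i\<in>UNIV. c $ i * x $ i)"

text \<open>
  The variables y(i,j) exist only for j in \<open>nbr Q i\<close>. The vector y is therefore a function on
  index pairs that is extensional on the following index set.
\<close>

definition pair_index :: "real ^ 'n ^ 'n \<Rightarrow> ('n \<times> 'n) set" where
  "pair_index Q = (SIGMA i:UNIV. nbr Q i)"

definition milp_obj ::
  "real ^ 'n ^ 'n \<Rightarrow> real ^ 'n \<Rightarrow> (real ^ 'n) \<times> ('n \<times> 'n \<Rightarrow> real) \<Rightarrow> real" where
  "milp_obj Q c = (\<lambda>(x, y).
     (\<Sum>i\<in>UNIV. \<Sum>j\<in>nbr Q i. Q $ i $ j * y (i, j)) + (\<Sum>i\<in>UNIV. c $ i * x $ i))"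

definition is_opt_sol :: "'a set \<Rightarrow> ('a \<Rightarrow> real) \<Rightarrow> 'a \<Rightarrow> bool" where
  "is_opt_sol S f z \<longleftrightarrow> is_arg_max f (\<lambda>w. w \<in> S) z"

text \<open>
  The optimal value is a relation, so that it only holds when the maximum is attained and no
  default value is involved for infeasible or unbounded problems.
\<close>

definition is_opt_value :: "'a set \<Rightarrow> ('a \<Rightarrow> real) \<Rightarrow> real \<Rightarrow> bool" where
  "is_opt_value S f v \<longleftrightarrow> (\<exists>z. is_opt_sol S f z \<and> f z = v)"

text \<open>
  A formulation is given by its set F of feasible pairs (x, y); its objective is always
  \<open>milp_obj Q c\<close>.
\<close>

definition valid_formulation ::
  "real ^ 'n ^ 'n \<Rightarrow> real ^ 'n \<Rightarrow> ((real ^ 'n) \<times> ('n \<times> 'n \<Rightarrow> real)) set \<Rightarrow> bool" where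
  "valid_formulation Q c F \<longleftrightarrow>
     (\<exists>v. is_opt_value F (milp_obj Q c) v \<and> is_opt_value binary_points (qubo_obj Q c) v) \<and>
     (\<forall>x y. is_opt_sol F (milp_obj Q c) (x, y) \<longrightarrow> is_opt_sol binary_points (qubo_obj Q c) x)"

definition FT_feasible ::
  "real ^ 'n ^ 'n \<Rightarrow> ('n \<Rightarrow> 'n \<Rightarrow> real) \<Rightarrow> ('n \<Rightarrow> 'n \<Rightarrow> real)
     \<Rightarrow> ((real ^ 'n) \<times> ('n \<times> 'n \<Rightarrow> real)) set" where
  "FT_feasible Q \<alpha> \<gamma> = {(x, y).
     y \<in> extensional (pair_index Q) \<and>
     (\<forall>i. (\<Sum>j\<in>nbr Q i. \<alpha> i j * (x $ j - y (i, j))) \<le> (\<Sum>j\<in>nbr Q i. \<alpha> i j) * (1 - x $ i)) \<and>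
     (\<forall>i. (\<Sum>j\<in>nbr Q i. \<gamma> i j * y (i, j)) \<le> (\<Sum>j\<in>nbr Q i. \<gamma> i j) * x $ i) \<and>
     (\<forall>i. \<forall>j\<in>nbr Q i. y (i, j) \<le> y (j, i)) \<and>
     (\<forall>i. x $ i \<in> {0, 1}) \<and>
     (\<forall>i. \<forall>j\<in>nbr Q i. 0 \<le> y (i, j) \<and> y (i, j) \<le> 1)}"

end

theory Submission
  imports Defs
begin

text \<open>
  The constraints force \<open>y (i, j) = x $ i * x $ j\<close>. The inequalities \<open>y (i, j) \<le> y (j, i)\<close> make
  \<open>y\<close> symmetric. If \<open>x $ i = 0\<close>, the \<open>\<gamma>\<close>-constraint bounds a positively weighted sum of nonnegative
  terms by \<open>0\<close>, so \<open>y (i, j) = 0 = y (j, i)\<close>. If \<open>x $ i = 1\<close>, the terms of the \<open>\<alpha>\<close>-constraint with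
  \<open>x $ j = 0\<close> vanish by symmetry and the others are nonnegative, so \<open>y (i, j) = 1\<close> whenever
  \<open>x $ j = 1\<close>. The feasible set is therefore a copy of the binary cube carrying the QUBO objective.
\<close>

text \<open>Feasible \<open>y\<close> are extensional on \<open>pair_index Q\<close>, hence the
  \<open>restrict\<close>: the lift is then the only feasible point over a binary
  \<open>x\<close>.\<close>

definition product_lift :: "real ^ 'n ^ 'n \<Rightarrow> real ^ 'n \<Rightarrow> (real ^ 'n) \<times> ('n \<times> 'n \<Rightarrow> real)" where
  "product_lift Q x = (x, restrict (\<lambda>(i, j). x $ i * x $ j) (pair_index Q))"

lemma milp_obj_product_lift: "milp_obj Q c (product_lift Q x) = qubo_obj Q c x"
  by (auto simp: milp_obj_def product_lift_def qubo_obj_def pair_index_def mult.assoc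
      intro!: sum.cong)

lemma nbr_sym:
  assumes "transpose Q = Q"
  shows "j \<in> nbr Q i \<longleftrightarrow> i \<in> nbr Q j"
proof -
  have "Q $ i $ j = Q $ j $ i"
    by (subst assms[symmetric]) (simp add: transpose_def)
  then show ?thesis
    by (simp add: nbr_def)
qed

text \<open>Nonnegative terms with a nonpositive sum all vanish, and positive weights cancel. It
  serves the \<gamma>-rows with \<open>z\<close> the entries of \<open>y\<close>, and the
  \<alpha>-rows with \<open>z\<close> the differences \<open>x $ l - y (i, l)\<close>.\<close>

lemma weighted_sum_nonpos_imp_zero:
  fixes w z :: "'a \<Rightarrow> real"
  assumes "finite A" and "\<And>j. j \<in> A \<Longrightarrow> w j > 0" and "\<And>j. j \<in> A \<Longrightarrow> z j \<ge> 0"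
    and "(\<Sum>j\<in>A. w j * z j) \<le> 0" and "j \<in> A"
  shows "z j = 0"
proof -
  have nonneg: "w k * z k \<ge> 0" if "k \<in> A" for k
    using assms(2,3)[OF that] by simp
  then have "(\<Sum>k\<in>A. w k * z k) = 0"
    using assms(4) sum_nonneg[of A "\<lambda>k. w k * z k"] by force
  then have "w j * z j = 0"
    using sum_nonneg_eq_0_iff[OF assms(1) nonneg] assms(5) by simp
  then show ?thesis
    using assms(2)[OF assms(5)] by simp
qed

lemma FT_feasible_imp_product:
  fixes Q :: "real ^ 'n ^ 'n"
  assumes sym: "transpose Q = Q"
    and \<alpha>: "\<And>i j. j \<in> nbr Q i \<Longrightarrow> \<alpha> i j > 0"
    and \<gamma>: "\<And>i j. j \<in> nbr Q i \<Longrightarrow> \<gamma> i j > 0"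
    and feas: "(x, y) \<in> FT_feasible Q \<alpha> \<gamma>"
    and j: "j \<in> nbr Q i"
  shows "y (i, j) = x $ i * x $ j"
proof -
  have A: "(\<Sum>j\<in>nbr Q i. \<alpha> i j * (x $ j - y (i, j))) \<le> (\<Sum>j\<in>nbr Q i. \<alpha> i j) * (1 - x $ i)"
    and G: "(\<Sum>j\<in>nbr Q i. \<gamma> i j * y (i, j)) \<le> (\<Sum>j\<in>nbr Q i. \<gamma> i j) * x $ i"
    and le: "j \<in> nbr Q i \<Longrightarrow> y (i, j) \<le> y (j, i)"
    and bin: "x $ i \<in> {0, 1}"
    and bounds: "j \<in> nbr Q i \<Longrightarrow> 0 \<le> y (i, j)" "j \<in> nbr Q i \<Longrightarrow> y (i, j) \<le> 1" for i j
    using feas by (auto simp: FT_feasible_def)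
  have row: "y (k, l) = 0" if "l \<in> nbr Q k" "x $ k = 0" for k l
    using weighted_sum_nonpos_imp_zero[of "nbr Q k" "\<gamma> k" "\<lambda>l. y (k, l)" l] G[of k] \<gamma> bounds that
    by simp
  have col: "y (k, l) = 0" if "l \<in> nbr Q k" "x $ l = 0" for k l
  proof -
    have "k \<in> nbr Q l"
      using that nbr_sym[OF sym] by blast
    then show ?thesis
      using le[of l k] row[of k l] bounds(1)[of l k] that by simp
  qed
  consider "x $ i = 0" | "x $ j = 0" | "x $ i = 1" "x $ j = 1"
    using bin[of i] bin[of j] by blast
  then show ?thesis
  proof cases
    case 3
    have "x $ l - y (i, l) \<ge> 0" if "l \<in> nbr Q i" for l
      using bin[of l] col[OF that] bounds(2)[OF that] by auto
    then have "x $ j - y (i, j) = 0"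
      using weighted_sum_nonpos_imp_zero[of "nbr Q i" "\<alpha> i" "\<lambda>l. x $ l - y (i, l)" j] A[of i] \<alpha> j 3
      by simp
    then show ?thesis
      using 3 by simp
  qed (use row col j in auto)
qed

text \<open>Both weighted inequalities hold term by term:
  \<open>x $ j * (1 - x $ i) \<le> 1 - x $ i\<close> and \<open>x $ i * x $ j \<le> x $ i\<close> on
  binary points.\<close>

lemma product_lift_feasible:
  assumes sym: "transpose Q = Q"
    and \<alpha>: "\<And>i j. j \<in> nbr Q i \<Longrightarrow> \<alpha> i j > 0"
    and \<gamma>: "\<And>i j. j \<in> nbr Q i \<Longrightarrow> \<gamma> i j > 0"
    and x: "x \<in> binary_points"
  shows "product_lift Q x \<in> FT_feasible Q \<alpha> \<gamma>"
proof -
  define y where "y = restrict (\<lambda>(i, j). x $ i * x $ j) (pair_index Q)"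
  have y: "y (i, j) = x $ i * x $ j" if "j \<in> nbr Q i" for i j
    using that by (simp add: y_def pair_index_def)
  have bin: "x $ i = 0 \<or> x $ i = 1" for i
    using x by (auto simp: binary_points_def)
  have x01: "0 \<le> x $ i" "x $ i \<le> 1" for i
    using bin[of i] by auto
  have "(\<Sum>j\<in>nbr Q i. \<alpha> i j * (x $ j - y (i, j))) \<le> (\<Sum>j\<in>nbr Q i. \<alpha> i j) * (1 - x $ i)" for i
    unfolding sum_distrib_right
  proof (rule sum_mono)
    fix j assume j: "j \<in> nbr Q i"
    show "\<alpha> i j * (x $ j - y (i, j)) \<le> \<alpha> i j * (1 - x $ i)"
      using bin[of i] x01[of j] \<alpha>[OF j] y[OF j] by auto
  qed
  moreover have "(\<Sum>j\<in>nbr Q i. \<gamma> i j * y (i, j)) \<le> (\<Sum>j\<in>nbr Q i. \<gamma> i j) * x $ i" for i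
    unfolding sum_distrib_right
  proof (rule sum_mono)
    fix j assume j: "j \<in> nbr Q i"
    show "\<gamma> i j * y (i, j) \<le> \<gamma> i j * x $ i"
      using bin[of i] x01[of j] \<gamma>[OF j] y[OF j] by auto
  qed
  \<comment> \<open>Symmetry of \<open>Q\<close> puts \<open>(j, i)\<close> in the index set too, so
    \<open>y (j, i)\<close> is a product and not the \<open>undefined\<close> of
    \<open>restrict\<close>.\<close>
  moreover have "y (i, j) \<le> y (j, i)" if "j \<in> nbr Q i" for i j
    using that nbr_sym[OF sym, of j i] by (simp add: y mult.commute)
  moreover have "0 \<le> y (i, j) \<and> y (i, j) \<le> 1" if "j \<in> nbr Q i" for i j
    using bin[of i] bin[of j] by (auto simp: y[OF that])
  moreover have "y \<in> extensional (pair_index Q)"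
    by (simp add: y_def)
  ultimately show ?thesis
    using bin by (auto simp: FT_feasible_def product_lift_def simp flip: y_def)
qed

lemma FT_feasible_eq_image:
  fixes Q :: "real ^ 'n ^ 'n"
  assumes "transpose Q = Q"
    and "\<And>i j. j \<in> nbr Q i \<Longrightarrow> \<alpha> i j > 0"
    and "\<And>i j. j \<in> nbr Q i \<Longrightarrow> \<gamma> i j > 0"
  shows "FT_feasible Q \<alpha> \<gamma> = product_lift Q ` binary_points"
proof (intro equalityI subsetI)
  fix z assume z: "z \<in> FT_feasible Q \<alpha> \<gamma>"
  obtain x y where xy: "z = (x, y)"
    by fastforce
  have ext: "y \<in> extensional (pair_index Q)" and x: "x \<in> binary_points"
    using z by (auto simp: xy FT_feasible_def binary_points_def)
  \<comment> \<open>Both sides are extensional, so agreement on \<open>pair_index Q\<close> gives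
    equality as functions.\<close>
  have "y = restrict (\<lambda>(i, j). x $ i * x $ j) (pair_index Q)"
    by (rule extensionalityI[OF ext])
      (use FT_feasible_imp_product[OF assms z[unfolded xy]] in \<open>auto simp: pair_index_def\<close>)
  then show "z \<in> product_lift Q ` binary_points"
    using x by (auto simp: xy product_lift_def)
next
  fix z assume "z \<in> product_lift Q ` binary_points"
  then obtain x where x: "x \<in> binary_points" "z = product_lift Q x"
    by blast
  show "z \<in> FT_feasible Q \<alpha> \<gamma>"
    unfolding x(2) by (rule product_lift_feasible[OF assms(1) _ _ x(1)]) (fact assms)+
qed

lemma is_opt_sol_image_iff:
  assumes "\<And>x. g (h x) = f x"
  shows "is_opt_sol (h ` S) g z \<longleftrightarrow> (\<exists>x. z = h x \<and> is_opt_sol S f x)"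
  using assms unfolding is_opt_sol_def is_arg_max_def by auto

text \<open>Finiteness makes the QUBO maximum attained, as \<open>is_opt_value\<close> demands. It
  is inherited from the finite function space \<open>UNIV \<rightarrow>\<^sub>E {0, 1}\<close>
  through \<open>vec_lambda\<close>.\<close>

lemma finite_binary_points: "finite (binary_points :: (real ^ 'n) set)"
proof -
  have "(binary_points :: (real ^ 'n) set) \<subseteq> vec_lambda ` (UNIV \<rightarrow>\<^sub>E {0, 1 :: real})"
  proof
    fix x :: "real ^ 'n"
    assume "x \<in> binary_points"
    then have "vec_nth x \<in> UNIV \<rightarrow>\<^sub>E {0, 1}"
      by (auto simp: binary_points_def)
    then have "vec_lambda (vec_nth x) \<in> vec_lambda ` (UNIV \<rightarrow>\<^sub>E {0, 1 :: real})"
      by (rule imageI)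
    then show "x \<in> vec_lambda ` (UNIV \<rightarrow>\<^sub>E {0, 1 :: real})"
      by simp
  qed
  then show ?thesis
    by (rule finite_subset) (simp add: finite_PiE)
qed

lemma is_opt_sol_exists:
  assumes "finite S" and "S \<noteq> {}"
  shows "\<exists>x. is_opt_sol S f x"
proof -
  obtain x where "x \<in> S" "f x = Max (f ` S)"
    using Max_in[of "f ` S"] assms by fastforce
  then have "is_opt_sol S f x"
    using assms(1) by (simp add: is_opt_sol_def is_arg_max_linorder)
  then show ?thesis ..
qed

theorem theorem12:
  fixes Q :: "real ^ 'n ^ 'n" and c :: "real ^ 'n"
    and \<alpha> \<gamma> :: "'n \<Rightarrow> 'n \<Rightarrow> real"
  assumes "transpose Q = Q"
    and "\<And>i. Q $ i $ i = 0"
    and "\<And>i j. j \<in> nbr Q i \<Longrightarrow> \<alpha> i j > 0"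
    and "\<And>i j. j \<in> nbr Q i \<Longrightarrow> \<gamma> i j > 0"
  shows "valid_formulation Q c (FT_feasible Q \<alpha> \<gamma>)"
proof -
  have "0 \<in> (binary_points :: (real ^ 'n) set)"
    by (simp add: binary_points_def)
  then obtain x where x: "is_opt_sol binary_points (qubo_obj Q c) x"
    using is_opt_sol_exists[OF finite_binary_points] by blast
  have image: "FT_feasible Q \<alpha> \<gamma> = product_lift Q ` binary_points"
    by (rule FT_feasible_eq_image) (fact assms)+
  \<comment> \<open>Read right to left, this lifts a QUBO optimum to a MILP optimum of equal value;
    left to right, it makes the \<open>x\<close>-part of any MILP optimum optimal for QUBO.\<close>
  have opt: "is_opt_sol (FT_feasible Q \<alpha> \<gamma>) (milp_obj Q c) z \<longleftrightarrow>
      (\<exists>x. z = product_lift Q x \<and> is_opt_sol binary_points (qubo_obj Q c) x)" for z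
    unfolding image
    by (rule is_opt_sol_image_iff) (rule milp_obj_product_lift)
  have "is_opt_value (FT_feasible Q \<alpha> \<gamma>) (milp_obj Q c) (qubo_obj Q c x)"
    using x opt milp_obj_product_lift unfolding is_opt_value_def by blast
  moreover have "is_opt_value binary_points (qubo_obj Q c) (qubo_obj Q c x)"
    using x unfolding is_opt_value_def by blast
  ultimately show ?thesis
    using opt unfolding valid_formulation_def by (auto simp: product_lift_def)
qed

end
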